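(* Let $0<u<v$ and $s\in(0,1]$, and let $q>1$ and $p$ satisfy $1/p+1/q=1$. Then $$\left|(s-1)L_s^s(u,v)+A^s(u,v)\right|\le \frac{L_p(u,v)}{2}\left(\frac{s}{s+1}\right)^{\frac1q}\left[\left(\left(\frac{u+v}{2}\right)^{(s-1)q}+v^{(s-1)q}\right)^{\frac1q}+\left(\left(\frac{u+v}{2}\right)^{(s-1)q}+u^{(s-1)q}\right)^{\frac1q}\right].$$
   Context: $A(u,v)=\frac{u+v}{2}$ is the arithmetic mean, and for $u,v>0$, $u\ne v$, $p\in\mathbb{R}\setminus\{-1,0\}$, $L_p(u,v)=\left(\frac{v^{p+1}-u^{p+1}}{(p+1)(v-u)}\right)^{1/p}$ is the generalized logarithmic mean. Notation: $A^s(u,v)=(A(u,v))^s$ and $L_s^s(u,v)=(L_s(u,v))^s=\frac{v^{s+1}-u^{s+1}}{(s+1)(v-u)}$. *)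

theory Defs
  imports Complex_Main
begin

definition arith_mean :: "real \<Rightarrow> real \<Rightarrow> real" where
  "arith_mean u v = (u + v) / 2"

text \<open>Meaningful only for \<open>u, v > 0\<close>, \<open>u \<noteq> v\<close> and \<open>p \<notin> {-1, 0}\<close>;
  the base of the outer power is then positive.\<close>

definition gen_log_mean :: "real \<Rightarrow> real \<Rightarrow> real \<Rightarrow> real" where
  "gen_log_mean p u v =
     ((v powr (p + 1) - u powr (p + 1)) / ((p + 1) * (v - u))) powr (1 / p)"

end

theory Submission
  imports Defs "HOL-Analysis.Convex"
begin

text \<open>
  Write \<open>A\<close> for the midpoint of \<open>[u, v]\<close> and \<open>E\<close> for the average of \<open>x powr s\<close> over
  \<open>[u, v]\<close>, so that \<open>L\<^sub>s\<^sup>s = E\<close>.  The left-hand side is \<open>A powr s - (1 - s) * E\<close>, which is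
  nonnegative because \<open>E \<le> A powr s\<close> by concavity; so only an upper bound for it is at stake.

  The bound is strong enough to hold after all exponents \<open>1/q\<close> have been removed from the
  right-hand side.  Indeed \<open>L\<^sub>p \<ge> A\<close> since \<open>p \<ge> 1\<close>, and each
  \<open>q\<close>-norm dominates the corresponding sum:
  \<open>(s/(s+1) * (a powr q + b powr q)) powr (1/q) \<ge> s/(s+1) * (a + b)\<close>, because the total weight
  \<open>2*s/(s+1)\<close> is at most \<open>1\<close>.  The right-hand side is therefore at least
  \<open>s/(s+1) * (A powr s + A * (u powr (s-1) + v powr (s-1)) / 2)\<close>.

  On the other side \<open>E\<close> is at least the mean of the endpoint values \<open>u powr s\<close> and
  \<open>v powr s\<close>, again by concavity.  What remains is an inequality that splits into one
  statement about \<open>u\<close> and the same statement about \<open>v\<close>, and this statement is an instance of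
  the weighted inequality between arithmetic and geometric means
  (\<open>powr_le_weighted_sum_powr\<close>).
\<close>

section \<open>Averages of convex and concave functions\<close>

text \<open>The average of a derivative \<open>f = F'\<close> over \<open>[a, b]\<close> is \<open>(F b - F a) / (b - a)\<close>; this
  form of the Hermite-Hadamard inequality needs no integration.  The proof pairs the points
  at distance \<open>h\<close> to the left and to the right of the midpoint: there the values of \<open>f\<close> sum
  to at least twice the value at the midpoint.\<close>

lemma convex_midpoint_le_average:
  fixes f F :: "real \<Rightarrow> real"
  assumes conv: "convex_on {a..b} f" and ab: "a < b"
    and deriv: "\<And>x. x \<in> {a..b} \<Longrightarrow> (F has_real_derivative f x) (at x)"
  shows "f ((a + b) / 2) \<le> (F b - F a) / (b - a)"
proof -
  define m r where "m = (a + b) / 2" and "r = (b - a) / 2"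
  define G where "G = (\<lambda>h. F (m + h) - F (m - h) - 2 * h * f m)"
  have "G 0 \<le> G r"
  proof (rule DERIV_nonneg_imp_nondecreasing[where f = G])
    show "0 \<le> r" using ab by (simp add: r_def)
    fix h :: real assume h: "0 \<le> h" "h \<le> r"
    have mem: "m + h \<in> {a..b}" "m - h \<in> {a..b}"
      using h by (auto simp: m_def r_def field_simps)
    have "((\<lambda>h. F (m + h)) has_real_derivative f (m + h) * 1) (at h)"
      by (rule DERIV_chain2[where f = F and g = "\<lambda>h. m + h", OF deriv[OF mem(1)]])
        (auto intro!: derivative_eq_intros)
    moreover have "((\<lambda>h. F (m - h)) has_real_derivative f (m - h) * (- 1)) (at h)"
      by (rule DERIV_chain2[where f = F and g = "\<lambda>h. m - h", OF deriv[OF mem(2)]])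
        (auto intro!: derivative_eq_intros)
    ultimately have "(G has_real_derivative f (m + h) + f (m - h) - 2 * f m) (at h)"
      unfolding G_def by (auto intro!: derivative_eq_intros)
    moreover have "2 * f m \<le> f (m + h) + f (m - h)"
      using convex_onD[OF conv _ _ mem, of "1/2"]
      by (simp add: algebra_simps flip: add_divide_distrib)
    ultimately show "\<exists>y. (G has_real_derivative y) (at h) \<and> 0 \<le> y"
      by (intro exI[of _ "f (m + h) + f (m - h) - 2 * f m"]) simp
  qed
  moreover have "m + r = b" "m - r = a" by (simp_all add: m_def r_def field_simps)
  ultimately have "2 * r * f m \<le> F b - F a"
    by (simp add: G_def)
  moreover have "2 * r = b - a" by (simp add: r_def)
  ultimately have "(b - a) * f m \<le> F b - F a" by simp
  then show ?thesis using ab by (simp add: m_def field_simps)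
qed

lemma concave_average_le_midpoint:
  fixes f F :: "real \<Rightarrow> real"
  assumes "concave_on {a..b} f" and "a < b"
    and "\<And>x. x \<in> {a..b} \<Longrightarrow> (F has_real_derivative f x) (at x)"
  shows "(F b - F a) / (b - a) \<le> f ((a + b) / 2)"
  using convex_midpoint_le_average[of a b "\<lambda>x. - f x" "\<lambda>x. - F x"] assms
  by (simp add: concave_on_def DERIV_minus field_simps)

text \<open>The other half of the Hermite-Hadamard inequality: a concave function lies above its
  chord, and the average of the chord is the mean of the endpoint values.\<close>

lemma concave_endpoint_mean_le_average:
  fixes f F :: "real \<Rightarrow> real"
  assumes conc: "concave_on {a..b} f" and ab: "a < b"
    and deriv: "\<And>x. x \<in> {a..b} \<Longrightarrow> (F has_real_derivative f x) (at x)"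
  shows "(f a + f b) / 2 \<le> (F b - F a) / (b - a)"
proof -
  define k where "k = (f b - f a) / (b - a)"
  define G where "G = (\<lambda>x. F x - f a * (x - a) - k * (x - a)^2 / 2)"
  have "G a \<le> G b"
  proof (rule DERIV_nonneg_imp_nondecreasing[where f = G])
    show "a \<le> b" using ab by simp
    fix x assume x: "a \<le> x" "x \<le> b"
    then have "(G has_real_derivative f x - f a - k * (x - a)) (at x)"
      unfolding G_def by (auto intro!: derivative_eq_intros deriv)
    moreover have "f a + k * (x - a) \<le> f x"
    proof -
      define t where "t = (x - a) / (b - a)"
      have "t * (b - a) = x - a" using ab by (simp add: t_def)
      then have "(1 - t) *\<^sub>R a + t *\<^sub>R b = x" by (simp add: algebra_simps)
      moreover have "0 \<le> t" "t \<le> 1" using x ab by (auto simp: t_def)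
      ultimately have t: "0 \<le> t" "t \<le> 1" "(1 - t) *\<^sub>R a + t *\<^sub>R b = x" by auto
      have "f a + k * (x - a) = (1 - t) * f a + t * f b"
        by (simp add: k_def t_def algebra_simps diff_divide_distrib)
      also have "\<dots> \<le> f x"
        using concave_onD[OF conc t(1,2), of a b] ab by (simp only: t(3)) simp
      finally show ?thesis .
    qed
    ultimately show "\<exists>y. (G has_real_derivative y) (at x) \<and> 0 \<le> y"
      by (intro exI[of _ "f x - f a - k * (x - a)"]) simp
  qed
  moreover have "k * (b - a)^2 = (f b - f a) * (b - a)"
    using ab by (simp add: k_def power2_eq_square)
  ultimately have "(f a + f b) / 2 * (b - a) \<le> F b - F a"
    by (simp add: G_def algebra_simps add_divide_distrib diff_divide_distrib)
  then show ?thesis using ab by (simp add: pos_le_divide_eq)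
qed

section \<open>Power functions and generalized logarithmic means\<close>

lemma has_real_derivative_powr_primitive:
  fixes x r :: real
  assumes "0 < x" and "r \<noteq> -1"
  shows "((\<lambda>x. x powr (r + 1) / (r + 1)) has_real_derivative x powr r) (at x)"
  using assms by (auto intro!: derivative_eq_intros)

lemma powr_concave:
  fixes s :: real
  assumes "0 \<le> s" and "s \<le> 1"
  shows "concave_on {0<..} (\<lambda>x. x powr s)"
proof (rule f''_le0_imp_concave)
  fix x :: real assume "x \<in> {0<..}"
  then show "((\<lambda>x. x powr s) has_real_derivative s * x powr (s - 1)) (at x)"
    and "((\<lambda>x. s * x powr (s - 1)) has_real_derivative s * ((s - 1) * x powr (s - 2))) (at x)"
    by (auto intro!: derivative_eq_intros)
  show "s * ((s - 1) * x powr (s - 2)) \<le> 0"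
    using assms by (intro mult_nonneg_nonpos mult_nonpos_nonneg) auto
qed simp

lemma gen_log_mean_powr:
  fixes u v r :: real
  assumes "0 < u" and "u < v" and "0 < r"
  shows "gen_log_mean r u v powr r = (v powr (r + 1) - u powr (r + 1)) / ((r + 1) * (v - u))"
proof -
  have "u powr (r + 1) < v powr (r + 1)"
    using assms by (intro powr_less_mono2) auto
  then show ?thesis
    using assms by (simp add: gen_log_mean_def powr_powr)
qed

lemma arith_mean_le_gen_log_mean:
  fixes u v p :: real
  assumes "0 < u" and "u < v" and "1 \<le> p"
  shows "arith_mean u v \<le> gen_log_mean p u v"
proof -
  define I where "I = (v powr (p + 1) - u powr (p + 1)) / ((p + 1) * (v - u))"
  have "convex_on {u..v} (\<lambda>x. x powr p)"
    using assms by (intro convex_on_subset[OF powr_convex]) auto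
  then have "arith_mean u v powr p \<le> I"
    using convex_midpoint_le_average[of u v "\<lambda>x. x powr p" "\<lambda>x. x powr (p + 1) / (p + 1)"] assms
    by (simp add: I_def arith_mean_def has_real_derivative_powr_primitive
        flip: diff_divide_distrib)
  then have "(arith_mean u v powr p) powr (1 / p) \<le> I powr (1 / p)"
    using assms by (intro powr_mono2) auto
  then show ?thesis
    using assms by (simp add: I_def gen_log_mean_def powr_powr arith_mean_def)
qed

text \<open>With \<open>c\<close> the midpoint of \<open>u\<close> and \<open>v\<close>, the mean of the instances \<open>x = u\<close> and \<open>x = v\<close> is
  the inequality between the reduced sides of the theorem.  The proof compares the weighted
  arithmetic and geometric means of \<open>x powr s\<close> and \<open>c * x powr (s - 1) / (s + 1)\<close>, with weights
  \<open>1 - s\<close> and \<open>s\<close>: in the geometric mean the powers of \<open>x\<close> cancel, which leaves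
  \<open>c powr s / (s + 1) powr s \<ge> c powr s / (s + 1)\<close>.\<close>

lemma powr_le_weighted_sum_powr:
  fixes c x s :: real
  assumes "0 < c" and "0 < x" and "0 \<le> s" and "s \<le> 1"
  shows "c powr s \<le> (1 - s) * x powr s + s / (s + 1) * (c powr s + c * x powr (s - 1))"
proof -
  define y where "y = c * x powr (s - 1) / (s + 1)"
  have "s * (1 - s) + (s - 1) * s = 0" by (simp add: algebra_simps)
  then have "x powr (s * (1 - s)) * x powr ((s - 1) * s) = 1"
    using assms by (simp flip: powr_add)
  then have "(x powr s) powr (1 - s) * y powr s = c powr s / (s + 1) powr s"
    using assms by (simp add: y_def powr_mult powr_divide powr_powr)
  moreover have "(x powr s) powr (1 - s) * y powr s \<le> (1 - s) * x powr s + s * y"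
    using assms by (intro Youngs_inequality_0) (auto simp: y_def)
  moreover have "c powr s / (s + 1) \<le> c powr s / (s + 1) powr s"
    using assms powr_mono[of s 1 "s + 1"] by (intro divide_left_mono) auto
  moreover have "c powr s = c powr s / (s + 1) + s / (s + 1) * c powr s"
    using assms by (simp add: divide_simps) (simp add: algebra_simps)
  ultimately show ?thesis
    by (simp add: y_def algebra_simps)
qed

text \<open>Two point masses \<open>w\<close> have total mass \<open>2 * w \<le> 1\<close>, and on such a measure the \<open>q\<close>-norm is
  at least the integral: convexity of \<open>x powr q\<close> handles the normalized measure, and the
  normalizing factor satisfies \<open>(2 * w) powr q \<le> 2 * w\<close>.\<close>

lemma weighted_sum_le_powr_norm:
  fixes a b w q :: real
  assumes "0 < a" and "0 < b" and "0 \<le> w" and "w \<le> 1 / 2" and "1 \<le> q"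
  shows "w * (a + b) \<le> w powr (1 / q) * (a powr q + b powr q) powr (1 / q)"
proof -
  have mean: "((a + b) / 2) powr q \<le> (a powr q + b powr q) / 2"
    using convex_onD[OF powr_convex[OF \<open>1 \<le> q\<close>], of "1/2" a b] assms
    by (simp add: field_simps)
  have "(2 * w) powr q \<le> 2 * w"
  proof (cases "w = 0")
    case False
    then show ?thesis using assms powr_mono'[of 1 q "2 * w"] by simp
  qed simp
  have "(w * (a + b)) powr q = (2 * w) powr q * ((a + b) / 2) powr q"
    using assms by (simp flip: powr_mult)
  also have "\<dots> \<le> (2 * w) * ((a powr q + b powr q) / 2)"
    using assms by (intro mult_mono mean \<open>(2 * w) powr q \<le> 2 * w\<close>) auto
  finally have "((w * (a + b)) powr q) powr (1 / q) \<le> (w * (a powr q + b powr q)) powr (1 / q)"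
    using assms by (intro powr_mono2) auto
  then show ?thesis
    using assms by (simp add: powr_powr powr_mult)
qed

section \<open>The inequality between the means\<close>

theorem proposition2:
  fixes u v s p q :: real
  assumes "0 < u" and "u < v"
    and "s \<in> {0<..1}"
    and "q > 1" and "1 / p + 1 / q = 1"
  shows "\<bar>(s - 1) * gen_log_mean s u v powr s + arith_mean u v powr s\<bar>
    \<le> gen_log_mean p u v / 2 * (s / (s + 1)) powr (1 / q)
      * ((((u + v) / 2) powr ((s - 1) * q) + v powr ((s - 1) * q)) powr (1 / q)
       + (((u + v) / 2) powr ((s - 1) * q) + u powr ((s - 1) * q)) powr (1 / q))"
proof -
  define A where "A = (u + v) / 2"
  define E where "E = gen_log_mean s u v powr s"
  define w where "w = s / (s + 1)"
  have s: "0 < s" "s \<le> 1" and A: "0 < A" "arith_mean u v = A"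
    using assms by (auto simp: A_def arith_mean_def)
  have w: "0 \<le> w" "w \<le> 1 / 2"
    using s by (auto simp: w_def field_simps)
  have "1 / p = 1 - 1 / q" using assms by simp
  moreover have "0 < 1 / q" "1 / q < 1" using assms by auto
  ultimately have "0 < 1 / p" "1 / p < 1" by linarith+
  then have p: "1 \<le> p" by (simp add: divide_less_eq split: if_splits)
  have E: "E = (v powr (s + 1) / (s + 1) - u powr (s + 1) / (s + 1)) / (v - u)"
    using gen_log_mean_powr[of u v s] assms s
    by (simp add: E_def flip: diff_divide_distrib)
  have conc: "concave_on {u..v} (\<lambda>x. x powr s)"
    using powr_concave[of s] assms s convex_on_subset[of "{0<..}" _ "{u..v}"]
    by (simp add: concave_on_def subset_eq)
  have deriv: "((\<lambda>x. x powr (s + 1) / (s + 1)) has_real_derivative x powr s) (at x)"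
    if "x \<in> {u..v}" for x
    using that assms s by (intro has_real_derivative_powr_primitive) auto
  have E_upper: "E \<le> A powr s"
    using concave_average_le_midpoint[OF conc \<open>u < v\<close> deriv] by (simp add: E A_def)
  have E_lower: "(u powr s + v powr s) / 2 \<le> E"
    using concave_endpoint_mean_le_average[OF conc \<open>u < v\<close> deriv] by (simp add: E)
  have "0 \<le> E" by (simp add: E_def)
  then have "(1 - s) * E \<le> A powr s"
    using E_upper s mult_left_le_one_le[of E "1 - s"] by simp
  then have "\<bar>(s - 1) * E + A powr s\<bar> = A powr s - (1 - s) * E"
    by (simp add: algebra_simps)
  also have "\<dots> \<le> A powr s - (1 - s) * ((u powr s + v powr s) / 2)"
    using E_lower s by (intro diff_left_mono mult_left_mono) auto
  also have "\<dots> \<le> w * (A powr s + A * (u powr (s - 1) + v powr (s - 1)) / 2)"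
    using powr_le_weighted_sum_powr[of A u s, folded w_def]
      powr_le_weighted_sum_powr[of A v s, folded w_def] assms s A
    by (simp add: field_simps)
  also have "\<dots> = A / 2 * (w * (A powr (s - 1) + v powr (s - 1))
                        + w * (A powr (s - 1) + u powr (s - 1)))"
    using A by (simp add: algebra_simps powr_diff)
  also have "\<dots> \<le> gen_log_mean p u v / 2
      * (w powr (1 / q) * ((A powr (s - 1)) powr q + (v powr (s - 1)) powr q) powr (1 / q)
       + w powr (1 / q) * ((A powr (s - 1)) powr q + (u powr (s - 1)) powr q) powr (1 / q))"
    using assms A w arith_mean_le_gen_log_mean[OF \<open>0 < u\<close> \<open>u < v\<close> p]
    by (intro mult_mono add_mono weighted_sum_le_powr_norm) auto
  finally show ?thesis
    by (simp only: A(2) powr_powr distrib_left mult.assoc E_def A_def w_def)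
qed

end
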